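(* Let $\lambda>0$ and $0<\nu\le1$. Then the solution $u_\nu$ of $\frac{\partial^{\nu}u}{\partial t^{\nu}}=\lambda^{2}\frac{\partial^{2}u}{\partial x^{2}}$, $x\in\mathbb{R}$, $t>0$, $u(x,0)=\delta(x)$, satisfies \[ u_{\nu}(x,t)=\int_{0}^{\infty}\frac{1}{\sqrt{4\pi w\lambda}}e^{-x^{2}/(4w\lambda)}\,\overline{u}_{2\nu}(w,t)\,dw, \] where $\overline{u}_{2\nu}(w,t)=2u_{2\nu}(w,t)$ for $w\ge0$ and $\overline{u}_{2\nu}(w,t)=0$ for $w<0$, and $u_{2\nu}$ is the solution of $\frac{\partial^{2\nu}u}{\partial t^{2\nu}}=\lambda^{2}\frac{\partial^{2}u}{\partial x^{2}}$ with $u(x,0)=\delta(x)$ when $0<\nu\le\frac12$, and with $u(x,0)=\delta(x)$, $u_t(x,0)=0$ when $\frac12<\nu\le1$.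
   Context: Fractional time derivatives are in the Dzherbashyan–Caputo sense: for $m-1<\mu<m$, $\frac{\partial^{\mu}u}{\partial t^{\mu}}(x,t)=\frac{1}{\Gamma(m-\mu)}\int_0^t (t-s)^{m-\mu-1}\frac{\partial^m u}{\partial s^m}(x,s)\,ds$, and for $\mu=m$ the ordinary derivative. For $0<\mu\le2$ the solution with the stated initial conditions is $u_\mu(x,t)=\frac{1}{2\lambda t^{\mu/2}}\sum_{k\ge0}\frac{(-|x|/(\lambda t^{\mu/2}))^k}{k!\,\Gamma(-\mu k/2+1-\mu/2)}$.
   Formalization: Solutions are taken as the explicit series. For ν=1 that series for u_2 vanishes identically, so the integral formula fails; there ū_2(·,t) is read as the Dirac mass at w=λt, and the claim becomes u_1(x,t) = the Gaussian kernel evaluated at w=λt. *)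

theory Defs
  imports "HOL-Analysis.Analysis"
begin

text \<open>Explicit fundamental solution of the time-fractional diffusion-wave equation
  \<partial>^mu u / \<partial> t^mu = lambda^2 u_xx (0 < mu \<le> 2), as given in the paper:
  u_mu(x,t) = 1/(2 lambda t^(mu/2)) * sum_k (-|x|/(lambda t^(mu/2)))^k / (k! Gamma(-mu k/2 + 1 - mu/2)).
  The reciprocal Gamma function rGamma is used, so that 1/Gamma at poles is 0.\<close>
definition frac_sol :: "real \<Rightarrow> real \<Rightarrow> real \<Rightarrow> real \<Rightarrow> real" where
  "frac_sol lam mu x t =
     1 / (2 * lam * t powr (mu / 2)) *
     (\<Sum>k. (- \<bar>x\<bar> / (lam * t powr (mu / 2))) ^ k * rGamma (- mu * real k / 2 + 1 - mu / 2) / fact k)"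

definition gauss_kernel :: "real \<Rightarrow> real \<Rightarrow> real \<Rightarrow> real" where
  "gauss_kernel lam w x = 1 / sqrt (4 * pi * w * lam) * exp (- x\<^sup>2 / (4 * w * lam))"

end

theory Submission
  imports
    Defs
    "HOL-Complex_Analysis.Complex_Analysis"
    "HOL-Probability.Distributions"
    "HOL-Real_Asymp.Real_Asymp"
begin

text \<open>
  Hankel's formula for the reciprocal Gamma function, with the contour deformed to the two rays of
  argument \<open>\<theta>\<close> and \<open>- \<theta>\<close>, turns the series of \<open>frac_sol lam (2 * nu) w t\<close> into the imaginary
  part of an integral along one ray whose integrand depends on \<open>w\<close> only through a factor
  \<open>exp (- q * w)\<close>, where \<open>q\<close> is proportional to \<open>z powr nu\<close> for the point \<open>z\<close> on the ray. Integrating against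
  the Gaussian kernel is then, by Fubini, its Laplace transform at \<open>q\<close>, which is
  \<open>exp (- \<bar>x\<bar> * sqrt (q / lam)) / (2 * sqrt (lam * q))\<close>. Since the square root of \<open>z powr nu\<close> is
  \<open>z powr (nu / 2)\<close>, the outcome is the same representation with \<open>nu\<close> halved.
  Laplace transforms at complex points are obtained from the real ones by analytic continuation.
\<close>

section \<open>Laplace transforms on the half-line\<close>

text \<open>Dominated convergence: every partial sum of the exponential series is bounded by
  \<open>exp (norm (c x))\<close>. This serves both for the power series of a Laplace transform and
  for the termwise evaluation of the Hankel-type integral.\<close>

lemma integral_exp_sums:
  fixes f c :: "'a \<Rightarrow> complex"
  assumes [measurable]: "f \<in> borel_measurable M" "c \<in> borel_measurable M"
    and int: "integrable M (\<lambda>x. norm (f x) * exp (norm (c x)))"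
  shows "(\<lambda>k. LINT x|M. f x * (c x ^ k / fact k)) sums (LINT x|M. f x * exp (c x))"
proof -
  have bound: "(\<Sum>k<n. norm (c x ^ k / fact k)) \<le> exp (norm (c x))" for n x
  proof -
    have "(\<Sum>k<n. norm (c x) ^ k / fact k) \<le> exp (norm (c x))"
      using sum_le_suminf[of "\<lambda>k. norm (c x) ^ k / fact k" "{..<n}"] summable_exp[of "norm (c x)"]
      by (simp add: exp_def scaleR_conv_of_real field_simps)
    then show ?thesis
      by (simp add: norm_divide norm_power)
  qed
  have trm: "integrable M (\<lambda>x. f x * (c x ^ k / fact k))" for k
  proof (rule Bochner_Integration.integrable_bound[OF int])
    have "norm (c x ^ k / fact k) \<le> exp (norm (c x))" for x
      using bound[of x "Suc k"] sum_nonneg[of "{..<k}" "\<lambda>k. norm (c x ^ k / fact k)"]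
      unfolding sum.lessThan_Suc by (smt (verit) norm_ge_zero)
    then have "norm (f x * (c x ^ k / fact k)) \<le> norm (f x) * exp (norm (c x))" for x
      unfolding norm_mult by (rule mult_left_mono) simp
    then show "AE x in M. norm (f x * (c x ^ k / fact k)) \<le> norm (norm (f x) * exp (norm (c x)))"
      by simp
  qed measurable
  have "(\<lambda>n. LINT x|M. (\<Sum>k<n. f x * (c x ^ k / fact k))) \<longlonglongrightarrow> (LINT x|M. f x * exp (c x))"
  proof (rule integral_dominated_convergence[OF _ _ int])
    show "AE x in M. (\<lambda>n. \<Sum>k<n. f x * (c x ^ k / fact k)) \<longlonglongrightarrow> f x * exp (c x)"
    proof (intro AE_I2)
      fix x
      have "(\<lambda>k. f x * (c x ^ k / fact k)) sums (f x * exp (c x))"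
        using sums_mult[OF exp_converges[of "c x"], of "f x"]
        by (simp add: scaleR_conv_of_real field_simps)
      then show "(\<lambda>n. \<Sum>k<n. f x * (c x ^ k / fact k)) \<longlonglongrightarrow> f x * exp (c x)"
        by (simp add: sums_def)
    qed
    show "AE x in M. norm (\<Sum>k<n. f x * (c x ^ k / fact k)) \<le> norm (f x) * exp (norm (c x))" for n
    proof (intro AE_I2)
      fix x
      have "norm (\<Sum>k<n. f x * (c x ^ k / fact k)) = norm (f x) * norm (\<Sum>k<n. c x ^ k / fact k)"
        by (simp only: norm_mult flip: sum_distrib_left)
      also have "\<dots> \<le> norm (f x) * exp (norm (c x))"
        by (intro mult_left_mono order_trans[OF norm_sum bound]) auto
      finally show "norm (\<Sum>k<n. f x * (c x ^ k / fact k)) \<le> norm (f x) * exp (norm (c x))" .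
    qed
  qed measurable
  then show ?thesis
    unfolding sums_def by (subst (asm) Bochner_Integration.integral_sum) (auto intro: trm simp del: times_divide_eq_right)
qed

text \<open>A restricted measure, rather than indicator factors, lets Fubini's theorem be applied to
  \<open>halfline\<close> directly. The endpoint 0, where integrands may be singular, is left
  out.\<close>

definition halfline :: "real measure" where
  "halfline = restrict_space lborel {0<..}"

lemma space_halfline [simp]: "space halfline = {0<..}"
  by (simp add: halfline_def space_restrict_space)

lemma borel_measurable_halfline [measurable (raw)]:
  "f \<in> borel_measurable borel \<Longrightarrow> f \<in> borel_measurable halfline"
  unfolding halfline_def by (rule measurable_restrict_space1) simp

lemma integrable_halfline: 
  fixes f :: "real \<Rightarrow> 'a::{banach, second_countable_topology}"
  shows "integrable halfline f \<longleftrightarrow> set_integrable lborel {0<..} f"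
  unfolding halfline_def set_integrable_def by (subst integrable_restrict_space) auto

lemma integral_halfline:
  fixes f :: "real \<Rightarrow> 'a::{banach, second_countable_topology}"
  shows "integral\<^sup>L halfline f = set_lebesgue_integral lborel {0<..} f"
  unfolding halfline_def set_lebesgue_integral_def by (subst integral_restrict_space) auto

lemma has_integral_halfline:
  fixes f :: "real \<Rightarrow> 'a::euclidean_space"
  assumes "integrable halfline f"
  shows "(f has_integral (LINT x|halfline. f x)) {0<..}"
  using set_borel_integral_eq_integral[of "{0<..}" f] assms
  by (simp add: integrable_halfline integral_halfline has_integral_iff)

lemma sigma_finite_halfline: "sigma_finite_measure halfline"
  unfolding halfline_def by (rule sigma_finite_measure_restrict_space[OF sigma_finite_lborel]) simp

definition laplace :: "(real \<Rightarrow> real) \<Rightarrow> complex \<Rightarrow> complex" where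
  "laplace g p = (LINT s|halfline. of_real (g s) * exp (- p * of_real s))"

lemma laplace_integrable:
  assumes [measurable]: "g \<in> borel_measurable borel"
    and int: "\<And>e. e > 0 \<Longrightarrow> integrable halfline (\<lambda>s. g s * exp (- e * s))"
    and "Re p > 0"
  shows "integrable halfline (\<lambda>s. of_real (g s) * exp (- p * of_real s))"
  by (rule Bochner_Integration.integrable_bound[OF int[OF assms(3)]])
    (auto simp: norm_mult)

text \<open>Around a real centre \<open>R\<close>, \<open>exp (- p * s)\<close> is
  \<open>exp (- R * s)\<close> times the exponential series in \<open>- (p - R) * s\<close>.
  Termwise integration is dominated when \<open>norm (p - R) < R\<close>, because a decay rate of
  \<open>R - norm (p - R)\<close> remains; this gives a power series on each such disc.\<close>

lemma laplace_holomorphic_on: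
  assumes [measurable]: "g \<in> borel_measurable borel"
    and int: "\<And>e. e > 0 \<Longrightarrow> integrable halfline (\<lambda>s. g s * exp (- e * s))"
  shows "laplace g holomorphic_on {p. Re p > 0}"
proof -
  have ball: "laplace g holomorphic_on ball (of_real R) R" for R
  proof (rule power_series_holomorphic)
    fix w :: complex assume w: "w \<in> ball (of_real R) R"
    define f where "f = (\<lambda>s. complex_of_real (g s) * exp (- of_real R * of_real s))"
    define c where "c = (\<lambda>s. - (w - of_real R) * complex_of_real s)" 
    have [measurable]: "f \<in> borel_measurable borel" "c \<in> borel_measurable borel"
      unfolding f_def c_def by measurable
    have norm_c: "norm (c s) = norm (w - of_real R) * s" if "s > 0" for s
      unfolding c_def norm_mult using that by (simp add: norm_minus_commute)
    have wR: "R - norm (w - of_real R) > 0"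
      using w by (simp add: dist_norm norm_minus_commute)
    have "(\<lambda>k. LINT s|halfline. f s * (c s ^ k / fact k)) sums (LINT s|halfline. f s * exp (c s))"
    proof (rule integral_exp_sums)
      have "integrable halfline (\<lambda>s. norm (g s * exp (- (R - norm (w - of_real R)) * s)))"
        using int[OF wR] by (rule integrable_norm)
      then show "integrable halfline (\<lambda>s. norm (f s) * exp (norm (c s)))"
        by (rule Bochner_Integration.integrable_cong[THEN iffD1, rotated 2])
          (auto simp: f_def norm_c norm_mult abs_mult ring_distribs mult_exp_exp add.commute)
    qed measurable
    moreover have "(LINT s|halfline. f s * exp (c s)) = laplace g w"
      unfolding laplace_def f_def c_def
      by (rule Bochner_Integration.integral_cong) (auto simp: mult.assoc mult_exp_exp ring_distribs)
    moreover have "(LINT s|halfline. f s * (c s ^ k / fact k)) =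
        (LINT s|halfline. f s * of_real s ^ k) * (- 1) ^ k / fact k * (w - of_real R) ^ k" for k
    proof -
      have "(LINT s|halfline. f s * (c s ^ k / fact k)) =
          (LINT s|halfline. ((- 1) ^ k / fact k * (w - of_real R) ^ k) * (f s * of_real s ^ k))"
        unfolding c_def power_mult_distrib power_minus[of "w - of_real R"]
        by (rule Bochner_Integration.integral_cong) (simp_all add: field_simps)
      then show ?thesis by simp
    qed
    ultimately show "(\<lambda>k. (LINT s|halfline. f s * of_real s ^ k) * (- 1) ^ k / fact k
        * (w - of_real R) ^ k) sums laplace g w"
      by simp
  qed
  show ?thesis
    unfolding holomorphic_on_def
  proof
    fix p :: complex assume "p \<in> {p. Re p > 0}"
    then have p: "Re p > 0" by simp
    \<comment> \<open>The discs with centre \<open>R\<close> and radius \<open>R\<close> exhaust the half-plane as \<open>R\<close> grows.\<close>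
    define R where "R = (norm p)\<^sup>2 / Re p"
    have "norm p > 0" using p by auto
    then have R: "R > 0" "R * Re p = (norm p)\<^sup>2"
      using p by (auto simp: R_def)
    \<comment> \<open>The choice of \<open>R\<close> makes the middle term twice the square of
      \<open>norm p\<close>, which outweighs the first term.\<close>
    have "(norm (p - of_real R))\<^sup>2 = (norm p)\<^sup>2 - 2 * (R * Re p) + R\<^sup>2"
      unfolding cmod_power2 by (simp add: power2_eq_square algebra_simps)
    also have "\<dots> < R\<^sup>2" using R \<open>norm p > 0\<close> by simp
    finally have "norm (p - of_real R) < R"
      using R by (auto intro: power_less_imp_less_base)
    then have "p \<in> ball (of_real R) R"
      by (simp add: dist_norm norm_minus_commute)
    then show "laplace g field_differentiable at p within {p. 0 < Re p}"
      using ball[of R] holomorphic_on_imp_differentiable_at field_differentiable_at_within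
      by blast
  qed
qed

text \<open>Identity theorem: the positive reals accumulate at 1 inside the connected right
  half-plane, so agreement there, where the integral is real, suffices.\<close>

lemma laplace_eqI:
  assumes "g \<in> borel_measurable borel"
    and "\<And>e. e > 0 \<Longrightarrow> integrable halfline (\<lambda>s. g s * exp (- e * s))"
    and h: "h holomorphic_on {p. Re p > 0}"
    and eq: "\<And>e. e > 0 \<Longrightarrow> of_real (LINT s|halfline. g s * exp (- e * s)) = h (of_real e)"
    and p: "Re p > 0"
  shows "laplace g p = h p"
proof -
  have "laplace g p - h p = 0"
  proof (rule analytic_continuation[of "\<lambda>p. laplace g p - h p" "{p. Re p > 0}" "of_real ` {0<..}" 1])
    show "(\<lambda>p. laplace g p - h p) holomorphic_on {p. Re p > 0}"
      by (intro holomorphic_intros laplace_holomorphic_on assms)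
    show "open {p. Re p > 0}" by (rule open_halfspace_Re_gt)
    show "connected {p. Re p > 0}" by (rule convex_connected[OF convex_halfspace_Re_gt])
    have "(1::real) islimpt {0<..}" by (rule interior_limit_point) (simp add: interior_open)
    then show "(1::complex) islimpt of_real ` {0<..}"
      using islimpt_isCont_image[of 1 "{0<..}" "of_real :: real \<Rightarrow> complex"]
      by (auto simp: eventually_at_filter)
    fix z :: complex assume "z \<in> of_real ` {0<..}"
    then obtain e where z: "z = of_real e" "e > 0" by auto
    have "laplace g z = (LINT s|halfline. complex_of_real (g s * exp (- e * s)))"
      unfolding laplace_def z by (simp flip: exp_of_real)
    then show "laplace g z - h z = 0"
      using eq[OF z(2)] unfolding integral_complex_of_real by (simp add: z)
  qed (use p in auto)
  then show ?thesis by simp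
qed

section \<open>The reciprocal Gamma function as an integral along a ray\<close>

lemma Gamma_integral_halfline:
  fixes a e :: real
  assumes "a > 0" "e > 0"
  shows "has_bochner_integral halfline (\<lambda>r. r powr (a - 1) * exp (- e * r)) (Gamma a * e powr (- a))"
proof -
  define f where "f = (\<lambda>t::real. indicator {0..} t * t powr (a - 1) / exp t)"
  have "has_bochner_integral lborel f (Gamma a)"
    unfolding f_def using assms Gamma_conv_nn_integral_real[of a]
    by (intro has_bochner_integral_nn_integral) (auto simp: less_imp_le)
  then have "has_bochner_integral lborel (\<lambda>x. f (0 + e * x)) (Gamma a /\<^sub>R \<bar>e\<bar>)"
    using assms by (subst (asm) lborel_has_bochner_integral_real_affine_iff[of e _ _ 0]) auto
  \<comment> \<open>The factor \<open>e powr (1 - a)\<close> cancels the power of \<open>e\<close>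
    coming from \<open>(e * x) powr (a - 1)\<close>.\<close>
  then have "has_bochner_integral lborel (\<lambda>x. e powr (1 - a) * f (0 + e * x)) (e powr (1 - a) * (Gamma a /\<^sub>R \<bar>e\<bar>))"
    by (rule has_bochner_integral_mult_right)
  also have "e powr (1 - a) * (Gamma a /\<^sub>R \<bar>e\<bar>) = Gamma a * e powr (- a)"
    using assms by (simp add: powr_diff powr_minus field_simps)
  also have "(\<lambda>x. e powr (1 - a) * f (0 + e * x)) =
      (\<lambda>x. indicator {0<..} x *\<^sub>R (x powr (a - 1) * exp (- e * x)))"
    using assms
    by (auto simp: f_def fun_eq_iff indicator_def zero_le_mult_iff powr_mult powr_diff exp_minus field_simps)
  finally show ?thesis
    by (simp add: has_bochner_integral_iff integrable_halfline integral_halfline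
        set_integrable_def set_lebesgue_integral_def)
qed

lemma Gamma_integral_complex_rate:
  fixes a :: real and p :: complex
  assumes a: "a > 0" and p: "Re p > 0"
  shows "(LINT r|halfline. of_real (r powr (a - 1)) * exp (- p * of_real r)) =
    of_real (Gamma a) * p powr of_real (- a)"
proof -
  have "laplace (\<lambda>r. r powr (a - 1)) p = of_real (Gamma a) * p powr of_real (- a)"
  proof (rule laplace_eqI[OF _ _ _ _ p])
    show "(\<lambda>p. of_real (Gamma a) * p powr of_real (- a)) holomorphic_on {p. 0 < Re p}"
      by (intro holomorphic_intros) (auto simp: complex_nonpos_Reals_iff)
    fix e :: real assume e: "e > 0"
    note G = Gamma_integral_halfline[OF a e, unfolded has_bochner_integral_iff]
    show "integrable halfline (\<lambda>r. r powr (a - 1) * exp (- e * r))"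
      using G by simp
    show "of_real (LINT r|halfline. r powr (a - 1) * exp (- e * r)) =
        of_real (Gamma a) * complex_of_real e powr of_real (- a)"
      using G e by (simp add: powr_of_real del: of_real_minus)
  qed measurable
  then show ?thesis by (simp add: laplace_def)
qed

text \<open>Euler's integral at the rate \<open>- cis \<theta>\<close>, which is
  \<open>cis (\<theta> - pi)\<close> and has positive real part, equals
  \<open>Gamma a * cis (- a * (\<theta> - pi))\<close>. The factor \<open>cis (a * \<theta>)\<close>
  rotates this to \<open>Gamma a * cis (a * pi)\<close>, and the reflection formula evaluates the
  imaginary part. For integer \<open>a\<close> both sides are 0.\<close>

lemma rGamma_eq_ray_integral:
  fixes a \<theta> :: real
  assumes a: "a > 0" and \<theta>: "pi / 2 < \<theta>" "\<theta> < pi"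
  shows "rGamma (1 - a) =
    Im (cis (a * \<theta>) * (LINT r|halfline. of_real (r powr (a - 1)) * exp (of_real r * cis \<theta>))) / pi"
proof -
  have cos: "cos \<theta> < 0"
    using \<theta> cos_monotone_0_pi[of "pi/2" \<theta>] by simp
  have neg: "- cis \<theta> = cis (\<theta> - pi)"
    by (simp add: complex_eq_iff)
  \<comment> \<open>The angle \<open>\<theta> - pi\<close> lies between \<open>- pi / 2\<close> and
    0, so the principal logarithm needs no correction by a multiple of
    \<open>2 * pi\<close>.\<close>
  have "Ln (cis (\<theta> - pi)) = \<i> * of_real (\<theta> - pi)"
    using \<theta> by (simp add: cis_conv_exp)
  then have powr: "cis (\<theta> - pi) powr of_real (- a) = cis (- a * (\<theta> - pi))"
    unfolding powr_def cis_conv_exp by (simp add: mult_ac)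
  have "(LINT r|halfline. of_real (r powr (a - 1)) * exp (of_real r * cis \<theta>)) =
      (LINT r|halfline. of_real (r powr (a - 1)) * exp (- (- cis \<theta>) * of_real r))"
    by (simp add: mult.commute)
  also have "\<dots> = of_real (Gamma a) * (- cis \<theta>) powr of_real (- a)"
    by (rule Gamma_integral_complex_rate) (use a cos in auto)
  finally have "cis (a * \<theta>) * (LINT r|halfline. of_real (r powr (a - 1)) * exp (of_real r * cis \<theta>)) =
      of_real (Gamma a) * cis (a * pi)"
    unfolding neg powr by (simp add: cis_mult algebra_simps)
  then have "Im (cis (a * \<theta>) * (LINT r|halfline. of_real (r powr (a - 1)) * exp (of_real r * cis \<theta>))) / pi =
      Gamma a * (sin (pi * a) / pi)"
    by (simp add: mult.commute)
  also have "sin (pi * a) / pi = rGamma a * rGamma (1 - a)"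
  proof -
    have "rGamma (1 - complex_of_real a) = of_real (rGamma (1 - a))"
      using rGamma_complex_of_real[of "1 - a"] by simp
    moreover have "sin (complex_of_real pi * of_real a) = of_real (sin (pi * a))"
      using sin_of_real[of "pi * a", where ?'a = complex] by simp
    ultimately have "complex_of_real (rGamma a * rGamma (1 - a)) = of_real (sin (pi * a) / pi)"
      using rGamma_reflection_complex[of "of_real a"]
      by (simp add: rGamma_complex_of_real)
    then show ?thesis by (simp only: of_real_eq_iff)
  qed
  also have "Gamma a * (rGamma a * rGamma (1 - a)) = rGamma (1 - a)"
    using Gamma_real_pos[OF a, THEN less_imp_neq, THEN not_sym, THEN right_inverse]
    by (simp add: rGamma_inverse_Gamma flip: mult.assoc)
  finally show ?thesis by simp
qed

section \<open>Laplace transform of the Gaussian kernel\<close>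

text \<open>This is \<open>sqrt pi / 2\<close> times the error function; the oriented interval
  integral makes it odd on the whole line.\<close>

definition gauss_int :: "real \<Rightarrow> real" where
  "gauss_int z = (LBINT y=0..z. exp (- y\<^sup>2))"

lemma gauss_int_has_derivative [derivative_intros]:
  "(gauss_int has_real_derivative exp (- z\<^sup>2)) (at z)"
proof -
  define a b where "a = - \<bar>z\<bar> - 1" and "b = \<bar>z\<bar> + 1"
  have "((\<lambda>u. LBINT y=0..u. exp (- y\<^sup>2)) has_vector_derivative exp (- z\<^sup>2)) (at z within {a..b})"
    unfolding zero_ereal_def
    by (rule interval_integral_FTC2) (auto simp: a_def b_def intro!: continuous_on_exp continuous_on_minus continuous_on_power continuous_on_id)
  moreover have "at z within {a..b} = at z"
    by (rule at_within_interior) (auto simp: a_def b_def)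
  ultimately show ?thesis
    by (simp add: has_real_derivative_iff_has_vector_derivative gauss_int_def[abs_def])
qed

lemma gauss_int_minus: "gauss_int (- z) = - gauss_int z"
proof -
  have "gauss_int z = (LBINT y=ereal (- z)..0. exp (- y\<^sup>2))"
    unfolding gauss_int_def
    by (subst interval_integral_reflect) simp
  also have "\<dots> = - gauss_int (- z)"
    unfolding gauss_int_def by (rule interval_integral_endpoints_reverse)
  finally show ?thesis by simp
qed

lemma gauss_int_at_top: "(gauss_int \<longlongrightarrow> sqrt pi / 2) at_top"
proof -
  have "((\<lambda>z. LINT x|lborel. indicator {..z} x *\<^sub>R (indicator {0..} x *\<^sub>R exp (- x\<^sup>2 :: real))) \<longlongrightarrow> sqrt pi / 2) at_top"
    using tendsto_integral_at_top[OF sets_lborel integrable.intros[OF gaussian_moment_0]]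
    unfolding has_bochner_integral_integral_eq[OF gaussian_moment_0] .
  moreover have "eventually (\<lambda>z. (LINT x|lborel. indicator {..z} x *\<^sub>R (indicator {0..} x *\<^sub>R exp (- x\<^sup>2))) = gauss_int z) at_top"
  proof (rule eventually_mono[OF eventually_ge_at_top[of 0]])
    fix z :: real assume "z \<ge> 0"
    then show "(LINT x|lborel. indicator {..z} x *\<^sub>R (indicator {0..} x *\<^sub>R exp (- x\<^sup>2))) = gauss_int z"
      unfolding gauss_int_def zero_ereal_def
      by (subst interval_integral_Icc)
        (auto simp: set_lebesgue_integral_def indicator_def intro!: Bochner_Integration.integral_cong)
  qed
  ultimately show ?thesis by (rule Lim_transform_eventually)
qed

lemma gauss_int_at_bot: "(gauss_int \<longlongrightarrow> - (sqrt pi / 2)) at_bot"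
  using tendsto_minus[OF gauss_int_at_top]
  by (subst filterlim_at_bot_mirror) (simp add: gauss_int_minus)

lemma gauss_kernel_measurable [measurable]: "(\<lambda>w. gauss_kernel lam w x) \<in> borel_measurable borel"
  unfolding gauss_kernel_def by measurable

lemma gauss_kernel_nonneg: "lam > 0 \<Longrightarrow> w > 0 \<Longrightarrow> gauss_kernel lam w x \<ge> 0"
  by (simp add: gauss_kernel_def)

text \<open>An explicit antiderivative with limits at 0 and at infinity gives the value; since the
  integrand is nonnegative, the same limits give integrability.\<close>

lemma gauss_kernel_laplace_real:
  fixes lam q x :: real
  assumes lam: "lam > 0" and q: "q > 0"
  shows "has_bochner_integral halfline (\<lambda>w. gauss_kernel lam w x * exp (- q * w))
    (exp (- (\<bar>x\<bar> / sqrt lam) * sqrt q) / (2 * sqrt lam * sqrt q))"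
proof -
  define d where "d = \<bar>x\<bar> / (2 * sqrt lam)"
  define \<beta> where "\<beta> = 2 * d * sqrt q"
  define C where "C = 2 * sqrt pi * sqrt lam * sqrt q"
  define zp zm where "zp = (\<lambda>w. sqrt q * sqrt w + d / sqrt w)"
    and "zm = (\<lambda>w. sqrt q * sqrt w - d / sqrt w)"
  \<comment> \<open>The classical antiderivative in terms of the error function.\<close>
  define F where "F w = (exp \<beta> * gauss_int (zp w) + exp (- \<beta>) * gauss_int (zm w)) / C" for w
  have C: "C > 0" using lam q by (simp add: C_def)
  have d: "d \<ge> 0" using lam by (simp add: d_def)
  have deriv: "(F has_real_derivative gauss_kernel lam w x * exp (- q * w)) (at w)" if w: "w > 0" for w
  proof -
    have dp: "(zp has_real_derivative sqrt q / (2 * sqrt w) - d / (2 * w * sqrt w)) (at w)"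
      unfolding zp_def using w by (auto intro!: derivative_eq_intros simp: field_simps)
    have dm: "(zm has_real_derivative sqrt q / (2 * sqrt w) + d / (2 * w * sqrt w)) (at w)"
      unfolding zm_def using w by (auto intro!: derivative_eq_intros simp: field_simps)
    \<comment> \<open>The cross terms \<open>\<beta>\<close> and \<open>- \<beta>\<close> are
      compensated by the factors \<open>exp \<beta>\<close> and \<open>exp (- \<beta>)\<close> in
      \<open>F\<close>. Both products then equal the same \<open>E\<close>, and the parts of the
      derivatives containing \<open>d\<close> cancel.\<close>
    have zp2: "(zp w)\<^sup>2 = q * w + \<beta> + d\<^sup>2 / w" and zm2: "(zm w)\<^sup>2 = q * w - \<beta> + d\<^sup>2 / w"
      using w q by (simp_all add: zp_def zm_def \<beta>_def power2_sum power2_diff power_mult_distrib power_divide)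
    define E where "E = exp (- q * w - d\<^sup>2 / w)"
    have Ep: "exp \<beta> * exp (- (zp w)\<^sup>2) = E" and Em: "exp (- \<beta>) * exp (- (zm w)\<^sup>2) = E"
      unfolding zp2 zm2 E_def by (simp_all add: mult_exp_exp algebra_simps)
    have "(F has_real_derivative (exp \<beta> * (exp (- (zp w)\<^sup>2) * (sqrt q / (2 * sqrt w) - d / (2 * w * sqrt w))) +
        exp (- \<beta>) * (exp (- (zm w)\<^sup>2) * (sqrt q / (2 * sqrt w) + d / (2 * w * sqrt w)))) / C) (at w)"
      unfolding F_def
      by (intro DERIV_cdivide DERIV_add DERIV_cmult
          DERIV_chain2[OF gauss_int_has_derivative dp] DERIV_chain2[OF gauss_int_has_derivative dm])
    also have "(exp \<beta> * (exp (- (zp w)\<^sup>2) * (sqrt q / (2 * sqrt w) - d / (2 * w * sqrt w))) +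
        exp (- \<beta>) * (exp (- (zm w)\<^sup>2) * (sqrt q / (2 * sqrt w) + d / (2 * w * sqrt w)))) / C =
        E * (sqrt q / sqrt w) / C"
      unfolding mult.assoc[symmetric] Ep Em by (simp add: field_simps)
    also have "\<dots> = gauss_kernel lam w x * exp (- q * w)"
    proof -
      have "E = exp (- x\<^sup>2 / (4 * w * lam)) * exp (- q * w)"
        using lam w by (simp add: E_def d_def power_divide power_mult_distrib mult_exp_exp field_simps)
      moreover have "sqrt (4 * pi * w * lam) = 2 * sqrt pi * sqrt w * sqrt lam"
        by (simp add: real_sqrt_mult)
      ultimately show ?thesis
        using q w lam by (simp add: C_def gauss_kernel_def field_simps)
    qed
    finally show ?thesis .
  qed
  have top: "filterlim zp at_top at_top" "filterlim zm at_top at_top"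
    unfolding zp_def zm_def using q by real_asymp+
  have B: "(F \<longlongrightarrow> (exp \<beta> * (sqrt pi / 2) + exp (- \<beta>) * (sqrt pi / 2)) / C) at_top"
    unfolding F_def using C
    by (intro tendsto_intros filterlim_compose[OF gauss_int_at_top] top) simp
  \<comment> \<open>For \<open>d > 0\<close> the argument \<open>zm w\<close> tends to minus
    infinity at 0. For \<open>d = 0\<close> both arguments tend to 0, but \<open>\<beta>\<close> is
    then 0 as well and the stated limit is again correct, namely 0.\<close>
  have A: "(F \<longlongrightarrow> (exp \<beta> * (sqrt pi / 2) - exp (- \<beta>) * (sqrt pi / 2)) / C) (at_right 0)"
  proof (cases "d = 0")
    case True
    have "isCont gauss_int 0"
      using DERIV_isCont[OF gauss_int_has_derivative] .
    moreover have "((\<lambda>w. sqrt q * sqrt w) \<longlongrightarrow> 0) (at_right 0)"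
      by real_asymp
    ultimately have "((\<lambda>w. gauss_int (sqrt q * sqrt w)) \<longlongrightarrow> gauss_int 0) (at_right 0)"
      by (rule isCont_tendsto_compose)
    moreover have "gauss_int 0 = 0"
      using gauss_int_minus[of 0] by simp
    ultimately have "((\<lambda>w. (gauss_int (sqrt q * sqrt w) + gauss_int (sqrt q * sqrt w)) / C) \<longlongrightarrow> (0 + 0) / C) (at_right 0)"
      using C by (intro tendsto_intros) auto
    then show ?thesis
      using True by (simp add: F_def[abs_def] \<beta>_def zp_def zm_def)
  next
    case False
    then have d: "d > 0" using d by simp
    have "filterlim zp at_top (at_right 0)" "filterlim zm at_bot (at_right 0)"
      unfolding zp_def zm_def using d by real_asymp+
    then have "(F \<longlongrightarrow> (exp \<beta> * (sqrt pi / 2) + exp (- \<beta>) * - (sqrt pi / 2)) / C) (at_right 0)"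
      unfolding F_def using C
      by (intro tendsto_intros filterlim_compose[OF gauss_int_at_top]
          filterlim_compose[OF gauss_int_at_bot]) simp_all
    then show ?thesis by simp
  qed
  have cont: "isCont (\<lambda>w. gauss_kernel lam w x * exp (- q * w)) w" if "w > 0" for w
    unfolding gauss_kernel_def using lam that by (auto intro!: continuous_intros)
  have "set_integrable lborel (einterval 0 \<infinity>) (\<lambda>w. gauss_kernel lam w x * exp (- q * w))"
    "(LBINT w=0..\<infinity>. gauss_kernel lam w x * exp (- q * w)) =
      (exp \<beta> * (sqrt pi / 2) + exp (- \<beta>) * (sqrt pi / 2)) / C -
      (exp \<beta> * (sqrt pi / 2) - exp (- \<beta>) * (sqrt pi / 2)) / C"
    using A B
    by (intro interval_integral_FTC_nonneg[where F = F] deriv cont;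
        simp add: ereal_tendsto_simps zero_ereal_def gauss_kernel_nonneg[OF lam])+
  moreover have "einterval 0 \<infinity> = {0<..}"
    by (auto simp: einterval_def zero_ereal_def)
  moreover have "(exp \<beta> * (sqrt pi / 2) + exp (- \<beta>) * (sqrt pi / 2)) / C -
      (exp \<beta> * (sqrt pi / 2) - exp (- \<beta>) * (sqrt pi / 2)) / C = exp (- \<beta>) / (2 * sqrt lam * sqrt q)"
  proof -
    have "C = 2 * sqrt pi * (sqrt lam * sqrt q)" by (simp add: C_def)
    then show ?thesis using lam q by (simp add: field_simps)
  qed
  moreover have "- \<beta> = - (\<bar>x\<bar> / sqrt lam) * sqrt q"
    by (simp add: \<beta>_def d_def)
  ultimately show ?thesis
    by (simp add: has_bochner_integral_iff integrable_halfline integral_halfline interval_lebesgue_integral_def)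
qed

text \<open>\<open>csqrt\<close> is holomorphic on the right half-plane and extends the real square
  root, so the real formula continues analytically.\<close>

lemma gauss_kernel_laplace:
  fixes q :: complex
  assumes lam: "lam > 0" and q: "Re q > 0"
  shows "laplace (\<lambda>w. gauss_kernel lam w x) q =
    exp (- of_real (\<bar>x\<bar> / sqrt lam) * csqrt q) / (2 * of_real (sqrt lam) * csqrt q)"
proof (rule laplace_eqI[OF _ _ _ _ q])
  show "(\<lambda>q. exp (- of_real (\<bar>x\<bar> / sqrt lam) * csqrt q) / (2 * of_real (sqrt lam) * csqrt q))
      holomorphic_on {q. Re q > 0}"
    using lam by (intro holomorphic_intros) (auto simp: complex_nonpos_Reals_iff)
  fix e :: real assume e: "e > 0"
  note G = gauss_kernel_laplace_real[OF lam e, of x, unfolded has_bochner_integral_iff]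
  show "integrable halfline (\<lambda>w. gauss_kernel lam w x * exp (- e * w))"
    using G by simp
  show "of_real (LINT w|halfline. gauss_kernel lam w x * exp (- e * w)) =
      exp (- of_real (\<bar>x\<bar> / sqrt lam) * csqrt (of_real e)) / (2 * of_real (sqrt lam) * csqrt (of_real e))"
    using G e by (simp flip: exp_of_real)
qed measurable

section \<open>Integral representation of the series\<close>

text \<open>Sublinear growth: this allows \<open>exp (\<bar>s\<bar> * r powr \<nu>)\<close> to be
  absorbed into the decay of \<open>exp (r * cos \<theta>)\<close>.\<close>

lemma powr_le_affine:
  fixes A \<nu> \<delta> :: real
  assumes "A \<ge> 0" "\<nu> > 0" "\<nu> < 1" "\<delta> > 0"
  obtains B where "\<And>r. r > 0 \<Longrightarrow> A * r powr \<nu> \<le> B + \<delta> * r"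
proof -
  \<comment> \<open>At \<open>r0\<close> the power \<open>A * r powr \<nu>\<close> meets the line
    \<open>\<delta> * r\<close>; up to there its value at \<open>r0\<close> bounds it, beyond it the
    line does.\<close>
  define r0 where "r0 = (A / \<delta>) powr (1 / (1 - \<nu>))"
  have r0: "r0 powr (1 - \<nu>) = A / \<delta>"
    using assms by (simp add: r0_def powr_powr)
  have "A * r powr \<nu> \<le> A * r0 powr \<nu> + \<delta> * r" if r: "r > 0" for r
  proof (cases "r \<le> r0")
    case True
    then have "A * r powr \<nu> \<le> A * r0 powr \<nu>"
      using assms r by (intro mult_left_mono powr_mono2) auto
    then show ?thesis using assms r by (simp add: add_increasing2)
  next
    case False
    then have "A / \<delta> \<le> r powr (1 - \<nu>)"
      unfolding r0[symmetric] using assms by (intro powr_mono2) (auto simp: r0_def)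
    then have "A * r powr \<nu> \<le> \<delta> * r powr (1 - \<nu>) * r powr \<nu>"
      using assms by (intro mult_right_mono) (auto simp: field_simps)
    also have "\<dots> = \<delta> * r"
      using r by (simp add: mult.assoc flip: powr_add)
    finally show ?thesis using assms by (simp add: add_increasing)
  qed
  then show ?thesis by (rule that)
qed

text \<open>The integrand of the Hankel-type representation of the series in \<open>frac_sol\<close>, on the ray of
  argument \<open>\<theta>\<close>; the conjugate ray contributes the conjugate integral. No arc around the origin
  is needed, since the singularity \<open>r powr (\<nu> - 1)\<close> is integrable.\<close>
definition wright_integrand :: "real \<Rightarrow> real \<Rightarrow> real \<Rightarrow> real \<Rightarrow> complex" where
  "wright_integrand \<theta> \<nu> s r = cis (\<nu> * \<theta>) * of_real (r powr (\<nu> - 1)) * exp (of_real r * cis \<theta>) *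
     exp (- of_real (s * r powr \<nu>) * cis (\<nu> * \<theta>))"

text \<open>Expanding the factor that contains \<open>s\<close> and integrating termwise, the
  \<open>k\<close>-th term collects the power \<open>r powr (\<nu> * Suc k - 1)\<close> and the
  phase \<open>cis (\<nu> * Suc k * \<theta>)\<close>. This is the ray integral for
  \<open>rGamma (1 - a)\<close> with \<open>a = \<nu> * Suc k\<close>.\<close>

lemma wright_integral_sums:
  fixes \<nu> \<theta> s :: real
  assumes \<nu>: "0 < \<nu>" "\<nu> < 1" and \<theta>: "pi / 2 < \<theta>" "\<theta> < pi"
  shows "(\<lambda>k. (- s) ^ k * rGamma (1 - \<nu> * real (Suc k)) / fact k) sums
    (Im (LINT r|halfline. wright_integrand \<theta> \<nu> s r) / pi)"
proof -
  define f where "f = (\<lambda>r. cis (\<nu> * \<theta>) * of_real (r powr (\<nu> - 1)) * exp (of_real r * cis \<theta>))"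
  define c where "c = (\<lambda>r. - complex_of_real (s * r powr \<nu>) * cis (\<nu> * \<theta>))"
  have [measurable]: "f \<in> borel_measurable borel" "c \<in> borel_measurable borel"
    unfolding f_def c_def by measurable
  have cos: "cos \<theta> < 0"
    using \<theta> cos_monotone_0_pi[of "pi/2" \<theta>] by simp
  \<comment> \<open>Half of the decay rate \<open>- cos \<theta>\<close> pays for the growth of the
    series; the other half keeps the integral finite.\<close>
  obtain B where B: "\<And>r. r > 0 \<Longrightarrow> \<bar>s\<bar> * r powr \<nu> \<le> B + (- cos \<theta> / 2) * r"
    using powr_le_affine[of "\<bar>s\<bar>" \<nu> "- cos \<theta> / 2"] \<nu> cos by auto
  have int: "integrable halfline (\<lambda>r. norm (f r) * exp (norm (c r)))"
  proof (rule Bochner_Integration.integrable_bound)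
    show "integrable halfline (\<lambda>r. exp B * (r powr (\<nu> - 1) * exp (- (- cos \<theta> / 2) * r)))"
      using has_bochner_integral_iff[THEN iffD1, OF Gamma_integral_halfline[of \<nu> "- cos \<theta> / 2"]] \<nu> cos
      by (intro integrable_mult_right) auto
    show "AE r in halfline. norm (norm (f r) * exp (norm (c r))) \<le>
        norm (exp B * (r powr (\<nu> - 1) * exp (- (- cos \<theta> / 2) * r)))"
    proof (rule AE_I2)
      fix r assume "r \<in> space halfline"
      then have r: "r > 0" by simp
      have "norm (f r) * exp (norm (c r)) = r powr (\<nu> - 1) * exp (r * cos \<theta> + \<bar>s\<bar> * r powr \<nu>)"
        by (simp add: f_def c_def norm_mult abs_mult exp_add)
      also have "\<dots> \<le> r powr (\<nu> - 1) * exp (B + r * cos \<theta> / 2)"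
        using B[OF r] by (intro mult_left_mono) (auto simp: field_simps)
      finally show "norm (norm (f r) * exp (norm (c r))) \<le>
          norm (exp B * (r powr (\<nu> - 1) * exp (- (- cos \<theta> / 2) * r)))"
        by (simp add: exp_add mult_ac)
    qed
  qed measurable
  have "(\<lambda>k. LINT r|halfline. f r * (c r ^ k / fact k)) sums (LINT r|halfline. f r * exp (c r))"
    by (rule integral_exp_sums[OF _ _ int]) measurable
  then have "(\<lambda>k. Im (LINT r|halfline. f r * (c r ^ k / fact k)) / pi) sums
      (Im (LINT r|halfline. f r * exp (c r)) / pi)"
    by (intro sums_divide sums_Im)
  moreover have "f r * exp (c r) = wright_integrand \<theta> \<nu> s r" for r
    by (simp add: f_def c_def wright_integrand_def)
  moreover have "Im (LINT r|halfline. f r * (c r ^ k / fact k)) / pi =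
      (- s) ^ k * rGamma (1 - \<nu> * real (Suc k)) / fact k" for k
  proof -
    \<comment> \<open>The prefactor \<open>r powr (\<nu> - 1)\<close> already carries one
      \<open>\<nu>\<close>, whence \<open>Suc k\<close> instead of \<open>k\<close>.\<close>
    define a where "a = \<nu> * real (Suc k)"
    have a: "a > 0" using \<nu> by (simp add: a_def)
    have "(LINT r|halfline. f r * (c r ^ k / fact k)) =
        (LINT r|halfline. (of_real ((- s) ^ k / fact k) * cis (a * \<theta>)) *
          (of_real (r powr (a - 1)) * exp (of_real r * cis \<theta>)))"
    proof (rule Bochner_Integration.integral_cong)
      fix r assume "r \<in> space halfline"
      then have r: "r > 0" by simp
      have "a - 1 = (\<nu> - 1) + real k * \<nu>"
        by (simp add: a_def algebra_simps)
      then have "r powr (a - 1) = r powr (\<nu> - 1) * r powr (real k * \<nu>)"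
        by (simp only: powr_add)
      also have "r powr (real k * \<nu>) = (r powr \<nu>) ^ k"
        using r by (simp add: powr_power)
      finally have "r powr (a - 1) = r powr (\<nu> - 1) * (r powr \<nu>) ^ k" .
      moreover have "a * \<theta> = \<nu> * \<theta> + real k * (\<nu> * \<theta>)"
        by (simp add: a_def algebra_simps)
      then have "cis (a * \<theta>) = cis (\<nu> * \<theta>) * cis (\<nu> * \<theta>) ^ k"
        by (simp add: Complex.DeMoivre cis_mult)
      moreover have "c r ^ k = of_real ((- s) ^ k) * of_real ((r powr \<nu>) ^ k) * cis (\<nu> * \<theta>) ^ k"
        by (simp add: c_def flip: power_mult_distrib)
      ultimately show "f r * (c r ^ k / fact k) =
          (of_real ((- s) ^ k / fact k) * cis (a * \<theta>)) * (of_real (r powr (a - 1)) * exp (of_real r * cis \<theta>))"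
        by (simp add: f_def)
    qed simp
    also have "\<dots> = of_real ((- s) ^ k / fact k) *
        (cis (a * \<theta>) * (LINT r|halfline. of_real (r powr (a - 1)) * exp (of_real r * cis \<theta>)))"
      unfolding integral_mult_right_zero mult.assoc ..
    moreover have Im_scale: "Im (of_real b * z) = b * Im z" for b z
      by simp
    ultimately have "Im (LINT r|halfline. f r * (c r ^ k / fact k)) / pi =
        (- s) ^ k / fact k *
        (Im (cis (a * \<theta>) * (LINT r|halfline. of_real (r powr (a - 1)) * exp (of_real r * cis \<theta>))) / pi)"
      by (simp only: Im_scale times_divide_eq_right)
    also have "\<dots> = (- s) ^ k / fact k * rGamma (1 - a)"
      unfolding rGamma_eq_ray_integral[OF a \<theta>] ..
    finally show ?thesis by (simp add: a_def)
  qed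
  ultimately show ?thesis by simp
qed

text \<open>The argument \<open>- \<nu> * k + 1 - \<nu>\<close> in the series is
  \<open>1 - \<nu> * Suc k\<close>. Any admissible \<open>\<theta>\<close> may be used, so solutions
  of two different orders can share one ray.\<close>

lemma frac_sol_eq_wright_integral:
  assumes "0 < \<nu>" "\<nu> < 1" "pi / 2 < \<theta>" "\<theta> < pi"
  shows "frac_sol lam (2 * \<nu>) x t = 1 / (2 * lam * t powr \<nu>) *
    (Im (LINT r|halfline. wright_integrand \<theta> \<nu> (\<bar>x\<bar> / (lam * t powr \<nu>)) r) / pi)"
  using sums_unique[OF wright_integral_sums[OF assms, of "\<bar>x\<bar> / (lam * t powr \<nu>)"]]
  by (simp add: frac_sol_def algebra_simps)

section \<open>Subordination\<close>

text \<open>After Fubini the integral over \<open>w\<close> is the Laplace transform of the kernel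
  at \<open>q r\<close>, which lies in the right half-plane because
  \<open>\<nu> * \<theta> < pi / 2\<close>. Taking \<open>csqrt (q r)\<close> halves both the
  exponent of \<open>r\<close> and the angle, which reproduces the integrand for
  \<open>\<nu> / 2\<close>.\<close>

lemma gauss_kernel_wright:
  fixes lam \<nu> x t \<theta> :: real
  assumes lam: "lam > 0" and t: "t > 0" and \<nu>: "0 < \<nu>" "\<nu> < 1"
    and \<theta>: "pi / 2 < \<theta>" "\<theta> < pi" "\<nu> * \<theta> < pi / 2"
  defines "T \<equiv> lam * t powr \<nu>"
  shows "integrable halfline (\<lambda>w. of_real (gauss_kernel lam w x) * (LINT r|halfline. wright_integrand \<theta> \<nu> (w / T) r))"
    and "(LINT w|halfline. of_real (gauss_kernel lam w x) * (LINT r|halfline. wright_integrand \<theta> \<nu> (w / T) r)) =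
      of_real (t powr (\<nu> / 2) / 2) *
      (LINT r|halfline. wright_integrand \<theta> (\<nu> / 2) (\<bar>x\<bar> / (lam * t powr (\<nu> / 2))) r)"
proof -
  interpret sigma_finite_measure halfline by (rule sigma_finite_halfline)
  interpret pair_sigma_finite halfline halfline ..
  define G where "G = (\<lambda>w. gauss_kernel lam w x)"
  define A where "A = (\<lambda>r. cis (\<nu> * \<theta>) * of_real (r powr (\<nu> - 1)) * exp (of_real r * cis \<theta>))"
  define q where "q = (\<lambda>r. of_real (r powr \<nu> / T) * cis (\<nu> * \<theta>))"
  define F where "F = (\<lambda>(r, w). of_real (G w) * wright_integrand \<theta> \<nu> (w / T) r)"
  have [measurable]: "G \<in> borel_measurable borel"
    unfolding G_def by measurable
  have T: "T > 0" using lam t by (simp add: T_def)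
  have cos: "cos \<theta> < 0"
    using \<theta> cos_monotone_0_pi[of "pi/2" \<theta>] by simp
  have cos_\<nu>: "cos (\<nu> * \<theta>) > 0"
    using \<theta> \<nu> pi_gt_zero by (intro cos_gt_zero_pi) (auto intro: less_trans[of _ 0])
  have Re_q: "Re (q r) > 0" if "r > 0" for r
    using that T cos_\<nu> by (simp add: q_def)
  have G_int: "has_bochner_integral halfline (\<lambda>w. G w * exp (- e * w))
      (exp (- (\<bar>x\<bar> / sqrt lam) * sqrt e) / (2 * sqrt lam * sqrt e))" if "e > 0" for e
    unfolding G_def by (rule gauss_kernel_laplace_real[OF lam that])
  have F_eq: "F (r, w) = A r * (of_real (G w) * exp (- q r * of_real w))" for r w
    by (simp add: F_def A_def q_def wright_integrand_def mult_ac)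
  have [measurable]: "fst \<in> borel_measurable (halfline \<Otimes>\<^sub>M halfline)"
      "snd \<in> borel_measurable (halfline \<Otimes>\<^sub>M halfline)"
    using measurable_compose[OF measurable_fst borel_measurable_halfline[OF measurable_ident]]
      measurable_compose[OF measurable_snd borel_measurable_halfline[OF measurable_ident]]
    by (simp_all add: id_def)
  have F_measurable [measurable]: "F \<in> borel_measurable (halfline \<Otimes>\<^sub>M halfline)"
    unfolding F_def wright_integrand_def by measurable
  have F_int: "integrable (halfline \<Otimes>\<^sub>M halfline) F"
  proof (rule Fubini_integrable[OF F_measurable])
    show "AE r in halfline. integrable halfline (\<lambda>w. F (r, w))"
    proof (rule AE_I2)
      fix r assume "r \<in> space halfline"
      then have "r > 0" by simp
      then have "integrable halfline (\<lambda>w. of_real (G w) * exp (- q r * of_real w))"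
        using G_int Re_q by (intro laplace_integrable) (auto simp: has_bochner_integral_iff)
      then show "integrable halfline (\<lambda>w. F (r, w))"
        unfolding F_eq by (rule integrable_mult_right)
    qed
    \<comment> \<open>\<open>sqrt (Re (q r))\<close> is \<open>r powr (\<nu> / 2)\<close> times a
      constant; \<open>K\<close> collects the constants of the bound.\<close>
    define K where "K = sqrt T / (2 * sqrt lam * sqrt (cos (\<nu> * \<theta>)))"
    show "integrable halfline (\<lambda>r. LINT w|halfline. norm (F (r, w)))"
    proof (rule Bochner_Integration.integrable_bound)
      show "integrable halfline (\<lambda>r. K * (r powr (\<nu> / 2 - 1) * exp (- (- cos \<theta>) * r)))"
        using has_bochner_integral_iff[THEN iffD1, OF Gamma_integral_halfline[of "\<nu> / 2" "- cos \<theta>"]] \<nu> cos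
        by (intro integrable_mult_right) auto
      show "AE r in halfline. norm (LINT w|halfline. norm (F (r, w))) \<le>
          norm (K * (r powr (\<nu> / 2 - 1) * exp (- (- cos \<theta>) * r)))"
      proof (rule AE_I2)
        fix r assume "r \<in> space halfline"
        then have r: "r > 0" by simp
        \<comment> \<open>The kernel is nonnegative and \<open>exp (- q r * w)\<close> has norm
          \<open>exp (- Re (q r) * w)\<close>, so the real transform at \<open>Re (q r)\<close>
          gives the value. Bounding its exponential by 1 leaves a power of \<open>r\<close>
          integrable at 0.\<close>
        have "(LINT w|halfline. norm (F (r, w))) =
            (LINT w|halfline. r powr (\<nu> - 1) * exp (r * cos \<theta>) * (G w * exp (- Re (q r) * w)))"
          using gauss_kernel_nonneg[OF lam]
          by (intro Bochner_Integration.integral_cong)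
            (auto simp: F_eq A_def norm_mult G_def)
        also have "\<dots> = r powr (\<nu> - 1) * exp (r * cos \<theta>) *
            (exp (- (\<bar>x\<bar> / sqrt lam) * sqrt (Re (q r))) / (2 * sqrt lam * sqrt (Re (q r))))"
          using G_int[OF Re_q[OF r]] by (simp add: has_bochner_integral_iff)
        also have "\<dots> \<le> r powr (\<nu> - 1) * exp (r * cos \<theta>) * (1 / (2 * sqrt lam * sqrt (Re (q r))))"
          using lam Re_q[OF r] by (intro mult_left_mono divide_right_mono) auto
        also have "\<dots> = K * (r powr (\<nu> / 2 - 1) * exp (- (- cos \<theta>) * r))"
        proof -
          have "sqrt (Re (q r)) = r powr (\<nu> / 2) * sqrt (cos (\<nu> * \<theta>)) / sqrt T"
            using r by (simp add: q_def real_sqrt_mult real_sqrt_divide powr_half_sqrt[symmetric] powr_powr)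
          moreover have "r powr (\<nu> - 1) = r powr (\<nu> / 2 - 1) * r powr (\<nu> / 2)"
            by (simp flip: powr_add)
          moreover have "P * R * E * (1 / (2 * L * (R * c / S))) = S / (2 * L * c) * (P * E)"
            if "R > 0" "L > 0" "c > 0" "S > 0" for P R E L c S :: real
            using that by (simp add: field_simps)
          ultimately show ?thesis
            using r T lam cos_\<nu> by (simp add: K_def mult.commute)
        qed
        finally show "norm (LINT w|halfline. norm (F (r, w))) \<le>
            norm (K * (r powr (\<nu> / 2 - 1) * exp (- (- cos \<theta>) * r)))"
          by simp
      qed
    qed measurable
  qed
  have inner: "(LINT r|halfline. F (r, w)) = of_real (G w) * (LINT r|halfline. wright_integrand \<theta> \<nu> (w / T) r)" for w
    by (simp add: F_def)
  show "integrable halfline (\<lambda>w. of_real (gauss_kernel lam w x) * (LINT r|halfline. wright_integrand \<theta> \<nu> (w / T) r))"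
    using integrable_snd[of "\<lambda>r w. F (r, w)"] F_int unfolding inner by (simp add: G_def)
  have "(LINT w|halfline. LINT r|halfline. F (r, w)) = (LINT r|halfline. LINT w|halfline. F (r, w))"
    using Fubini_integral[of "\<lambda>r w. F (r, w)"] F_int by simp
  also have "\<dots> = (LINT r|halfline. of_real (t powr (\<nu> / 2) / 2) *
      wright_integrand \<theta> (\<nu> / 2) (\<bar>x\<bar> / (lam * t powr (\<nu> / 2))) r)"
  proof (rule Bochner_Integration.integral_cong)
    fix r assume "r \<in> space halfline"
    then have r: "r > 0" by simp
    \<comment> \<open>Square roots of \<open>t powr \<nu>\<close>, \<open>r powr \<nu>\<close> and
      \<open>cis (\<nu> * \<theta>)\<close>, in which all quantities below are rational up to
      \<open>sqrt lam\<close>.\<close>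
    define \<sigma> where "\<sigma> = t powr (\<nu> / 2)"
    define \<rho> where "\<rho> = r powr (\<nu> / 2)"
    define u where "u = cis (\<nu> / 2 * \<theta>)"
    have \<sigma>: "\<sigma> > 0" "\<rho> > 0" using t r by (simp_all add: \<sigma>_def \<rho>_def)
    have u2: "cis (\<nu> * \<theta>) = u * u" by (simp add: u_def cis_mult)
    have T\<sigma>: "T = lam * (\<sigma> * \<sigma>)" by (simp add: T_def \<sigma>_def flip: powr_add)
    have \<rho>2: "r powr \<nu> = \<rho> * \<rho>" by (simp add: \<rho>_def flip: powr_add)
    \<comment> \<open>The candidate has argument \<open>\<nu> / 2 * \<theta>\<close>, below
      \<open>pi / 2\<close>, hence positive real part; this singles out the principal root.\<close>
    have "csqrt (q r) = of_real (\<rho> / (sqrt lam * \<sigma>)) * u"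
    proof (rule csqrt_unique)
      have "r powr \<nu> / T = \<rho> / (sqrt lam * \<sigma>) * (\<rho> / (sqrt lam * \<sigma>))"
        unfolding \<rho>2 T\<sigma> using lam by simp
      then have "q r = of_real (\<rho> / (sqrt lam * \<sigma>) * (\<rho> / (sqrt lam * \<sigma>))) * (u * u)"
        by (simp only: q_def u2)
      then show "(of_real (\<rho> / (sqrt lam * \<sigma>)) * u)\<^sup>2 = q r"
        by (simp add: power2_eq_square)
      have "cos (\<nu> / 2 * \<theta>) > 0"
        using \<theta> \<nu> pi_gt_zero by (intro cos_gt_zero_pi) (auto intro: less_trans[of _ 0])
      then show "0 < Re (of_real (\<rho> / (sqrt lam * \<sigma>)) * u) \<or>
          Re (of_real (\<rho> / (sqrt lam * \<sigma>)) * u) = 0 \<and> 0 \<le> Im (of_real (\<rho> / (sqrt lam * \<sigma>)) * u)"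
        using \<sigma> lam by (simp add: u_def)
    qed
    then have L: "laplace G (q r) = exp (- of_real (\<bar>x\<bar> / sqrt lam) * (of_real (\<rho> / (sqrt lam * \<sigma>)) * u)) /
        (2 * of_real (sqrt lam) * (of_real (\<rho> / (sqrt lam * \<sigma>)) * u))"
      unfolding G_def by (simp only: gauss_kernel_laplace[OF lam Re_q[OF r]])
    have e: "- complex_of_real (\<bar>x\<bar> / sqrt lam) * (of_real (\<rho> / (sqrt lam * \<sigma>)) * u) =
        - of_real (\<bar>x\<bar> / (lam * \<sigma>) * \<rho>) * u"
      using lam by (simp flip: of_real_mult mult.assoc)
    have den: "2 * of_real (sqrt lam) * (of_real (\<rho> / (sqrt lam * \<sigma>)) * u) = of_real (2 * \<rho> / \<sigma>) * u"
      using lam by simp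
    have "(LINT w|halfline. F (r, w)) = A r * laplace G (q r)"
      unfolding F_eq laplace_def by simp
    \<comment> \<open>Division by \<open>csqrt (q r)\<close> removes one of the two factors
      \<open>u\<close> of \<open>A r\<close>; the \<open>\<rho>\<close> in the denominator will
      lower the exponent \<open>\<nu> - 1\<close> to \<open>\<nu> / 2 - 1\<close>.\<close>
    also have "\<dots> = of_real (r powr (\<nu> - 1) / (2 * \<rho> / \<sigma>)) * (u * exp (of_real r * cis \<theta>) *
        exp (- of_real (\<bar>x\<bar> / (lam * \<sigma>) * \<rho>) * u))"
      unfolding L e den A_def u2 using \<sigma> by (simp add: u_def)
    also have "r powr (\<nu> - 1) / (2 * \<rho> / \<sigma>) = \<sigma> / 2 * r powr (\<nu> / 2 - 1)"
    proof -
      have "r powr (\<nu> - 1) = r powr (\<nu> / 2 - 1) * \<rho>"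
        by (simp add: \<rho>_def flip: powr_add)
      then show ?thesis using \<sigma> by simp
    qed
    also have "of_real (\<sigma> / 2 * r powr (\<nu> / 2 - 1)) * (u * exp (of_real r * cis \<theta>) *
        exp (- of_real (\<bar>x\<bar> / (lam * \<sigma>) * \<rho>) * u)) =
        of_real (\<sigma> / 2) * wright_integrand \<theta> (\<nu> / 2) (\<bar>x\<bar> / (lam * \<sigma>)) r"
      by (simp add: wright_integrand_def u_def \<rho>_def)
    finally show "(LINT w|halfline. F (r, w)) = of_real (t powr (\<nu> / 2) / 2) *
        wright_integrand \<theta> (\<nu> / 2) (\<bar>x\<bar> / (lam * t powr (\<nu> / 2))) r"
      by (simp add: \<sigma>_def)
  qed simp
  finally show "(LINT w|halfline. of_real (gauss_kernel lam w x) * (LINT r|halfline. wright_integrand \<theta> \<nu> (w / T) r)) =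
      of_real (t powr (\<nu> / 2) / 2) *
      (LINT r|halfline. wright_integrand \<theta> (\<nu> / 2) (\<bar>x\<bar> / (lam * t powr (\<nu> / 2))) r)"
    unfolding inner G_def by simp
qed

section \<open>The limiting case \<open>nu = 1\<close>: the heat kernel\<close>

text \<open>The recurrence of \<open>rGamma\<close> is run downwards from
  \<open>rGamma (1 / 2)\<close>. The form with \<open>fact (2 * j)\<close> is chosen to cancel the
  factorial in the even terms of the series.\<close>

lemma rGamma_half_minus_nat:
  "rGamma (1 / 2 - real j) = (-1) ^ j * fact (2 * j) / (4 ^ j * fact j * sqrt pi)"
proof (induction j)
  case 0
  then show ?case by (simp add: rGamma_inverse_Gamma Gamma_one_half_real field_simps)
next
  case (Suc j)
  have "rGamma (1 / 2 - real (Suc j)) = (1 / 2 - real (Suc j)) * rGamma (1 / 2 - real (Suc j) + 1)"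
    by (rule rGamma_plus1[symmetric])
  also have "1 / 2 - real (Suc j) + 1 = 1 / 2 - real j" by simp
  also have "(1 / 2 - real (Suc j)) * rGamma (1 / 2 - real j) =
      (-1) ^ Suc j * (2 * real (Suc j) * (2 * real (Suc j) - 1) * fact (2 * j)) /
      (4 * real (Suc j) * (4 ^ j * fact j * sqrt pi))"
  proof -
    have "(1 / 2 - K) * (p * F / D) = - p * (2 * K * (2 * K - 1) * F) / (4 * K * D)"
      if "K > 0" "D > 0" for K D p F :: real
      using that by (simp add: field_simps)
    from this[of "real (Suc j)" "4 ^ j * fact j * sqrt pi" "(-1) ^ j" "fact (2 * j)"]
    show ?thesis unfolding Suc.IH by simp
  qed
  also have "2 * real (Suc j) * (2 * real (Suc j) - 1) * fact (2 * j) = fact (2 * Suc j)"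
    by (simp add: algebra_simps)
  also have "4 * real (Suc j) * (4 ^ j * fact j * sqrt pi) = 4 ^ Suc j * fact (Suc j) * sqrt pi"
    by (simp add: algebra_simps)
  finally show ?case .
qed

text \<open>For odd \<open>k\<close> the argument of \<open>rGamma\<close> is a pole of Gamma and
  the term vanishes; the even terms form the exponential series at
  \<open>- (y\<^sup>2 / 4)\<close>.\<close>

lemma frac_sol_one:
  assumes lam: "lam > 0" and t: "t > 0"
  shows "frac_sol lam 1 x t = gauss_kernel lam (lam * t) x"
proof -
  define y where "y = \<bar>x\<bar> / (lam * sqrt t)"
  define f where "f = (\<lambda>k. (- y) ^ k * rGamma (1 / 2 - real k / 2) / fact k)"
  have even: "f (2 * j) = (- (y\<^sup>2 / 4)) ^ j / fact j / sqrt pi" for j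
  proof -
    have "(- y) ^ (2 * j) = (y\<^sup>2) ^ j" by (simp add: power_mult)
    then show ?thesis
      by (simp add: f_def rGamma_half_minus_nat power_minus[of "y\<^sup>2 / 4"] power_divide mult_ac)
  qed
  have odd: "f k = 0" if k: "k \<notin> range ((*) 2)" for k
  proof -
    from k have "odd k" by (auto elim!: evenE)
    then obtain j where "k = 2 * j + 1" by (auto elim: oddE)
    then have "1 / 2 - real k / 2 = - of_nat j" by (simp add: field_simps)
    then have "rGamma (1 / 2 - real k / 2) = 0"
      by (simp only: rGamma_eq_zero_iff) simp
    then show ?thesis by (simp add: f_def)
  qed
  have "(\<lambda>j. (- (y\<^sup>2 / 4)) ^ j / fact j / sqrt pi) sums (exp (- (y\<^sup>2 / 4)) / sqrt pi)"
    using exp_converges[of "- (y\<^sup>2 / 4)"] by (intro sums_divide) (simp add: field_simps)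
  then have "f sums (exp (- (y\<^sup>2 / 4)) / sqrt pi)"
    using sums_mono_reindex[of "(*) (2::nat)" f] odd by (simp add: strict_mono_def even)
  then have "(\<Sum>k. f k) = exp (- (y\<^sup>2 / 4)) / sqrt pi"
    by (rule sums_unique[symmetric])
  moreover have "frac_sol lam 1 x t = 1 / (2 * lam * sqrt t) * (\<Sum>k. f k)"
    using t by (simp add: frac_sol_def f_def y_def powr_half_sqrt algebra_simps)
  moreover have "y\<^sup>2 / 4 = x\<^sup>2 / (4 * (lam * t) * lam)"
    using t by (simp add: y_def power_divide power_mult_distrib power2_eq_square)
  moreover have "sqrt (4 * pi * (lam * t) * lam) = 2 * lam * sqrt t * sqrt pi"
    using lam by (simp add: real_sqrt_mult)
  ultimately show ?thesis by (simp add: gauss_kernel_def)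
qed

text \<open>For \<open>nu = 1\<close> the solution of order 2 is the wave solution, half the sum of
  the point masses at \<open>lam * t\<close> and \<open>- lam * t\<close>. Doubled and restricted to
  the half-line it is the unit mass at \<open>lam * t\<close>, so the integral becomes the value of
  the kernel there; the second conjunct states this.\<close>

theorem theorem2p3:
  fixes lam nu x t :: real
  assumes "lam > 0" and "0 < nu" and "nu \<le> 1" and "t > 0"
  shows "(nu < 1 \<longrightarrow>
           ((\<lambda>w. gauss_kernel lam w x * (2 * frac_sol lam (2 * nu) w t)) has_integral
              frac_sol lam nu x t) {0<..})
       \<and> (nu = 1 \<longrightarrow> frac_sol lam nu x t = gauss_kernel lam (lam * t) x)"
proof (intro conjI impI)
  assume "nu = 1"
  then show "frac_sol lam nu x t = gauss_kernel lam (lam * t) x"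
    using frac_sol_one assms by simp
next
  assume nu: "nu < 1"
  \<comment> \<open>The angle must exceed \<open>pi / 2\<close> for \<open>exp (r * cis \<theta>)\<close> to decay, while
    \<open>nu * \<theta> < pi / 2\<close> keeps the Laplace variable in the right half-plane.\<close>
  define \<theta> where "\<theta> = pi / (1 + nu)"
  \<comment> \<open>Here \<open>nu * \<theta>\<close> equals \<open>pi - \<theta>\<close>, so the
    third inequality is equivalent to the first.\<close>
  have \<theta>: "pi / 2 < \<theta>" "\<theta> < pi" "nu * \<theta> < pi / 2"
    using assms nu pi_gt_zero by (simp_all add: \<theta>_def field_simps)
  define T \<sigma> where "T = lam * t powr nu" and "\<sigma> = t powr (nu / 2)"
  have \<sigma>: "\<sigma> > 0" using assms by (simp add: \<sigma>_def)
  have T\<sigma>: "T = lam * (\<sigma> * \<sigma>)" by (simp add: T_def \<sigma>_def flip: powr_add)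
  define I where "I = (\<lambda>w. of_real (gauss_kernel lam w x) * (LINT r|halfline. wright_integrand \<theta> nu (w / T) r))"
  define J where "J = (LINT r|halfline. wright_integrand \<theta> (nu / 2) (\<bar>x\<bar> / (lam * \<sigma>)) r)"
  note subord = gauss_kernel_wright[OF assms(1,4,2) nu \<theta>, of x, folded T_def \<sigma>_def, folded I_def J_def]
  \<comment> \<open>The factor 2 cancels that of the prefactor \<open>1 / (2 * T)\<close> of order
    \<open>2 * nu\<close>, whence the normalisation by \<open>pi * T\<close>.\<close>
  have 1: "((\<lambda>w. Im (I w) / (pi * T)) has_integral Im (of_real (\<sigma> / 2) * J) / (pi * T)) {0<..}"
    using has_integral_divide[OF has_integral_Im[OF has_integral_halfline[OF subord(1)]], of "pi * T"]
    unfolding subord(2) .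
  \<comment> \<open>Dividing \<open>\<sigma> / 2\<close> by
    \<open>lam * (\<sigma> * \<sigma>)\<close> leaves \<open>1 / (2 * lam * \<sigma>)\<close>, the
    prefactor of order \<open>nu\<close>.\<close>
  have 2: "Im (of_real (\<sigma> / 2) * J) / (pi * T) = frac_sol lam nu x t"
    using frac_sol_eq_wright_integral[of "nu / 2" \<theta> lam x t] assms nu \<theta> \<sigma>
    by (simp add: T\<sigma> J_def \<sigma>_def)
  have 3: "Im (I w) / (pi * T) = gauss_kernel lam w x * (2 * frac_sol lam (2 * nu) w t)"
    if "w \<in> {0<..}" for w
    using frac_sol_eq_wright_integral[of nu \<theta> lam w t] assms nu \<theta> that
    by (simp add: I_def T_def)
  show "((\<lambda>w. gauss_kernel lam w x * (2 * frac_sol lam (2 * nu) w t)) has_integral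
      frac_sol lam nu x t) {0<..}"
    using has_integral_eq[OF 3 1] unfolding 2 .
qed

end
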